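(* There are absolute constants $c_5,c_6>0$ such that the following holds. Let $D\subset\mathbb R^d$ be compact and let $K\colon D\times D\to\mathbb C$ be a continuous Hermitian positive definite kernel with $\sup_{x\in D}\sqrt{K(x,x)}<\infty$ whose reproducing kernel Hilbert space $H(K)$ is infinite dimensional. If there is a finite Borel measure $\varrho_D$ on $D$ with full support such that $N_{K,\varrho_D}(k)=\mathcal O(k)$ as $k\to\infty$, then there is a constant $C_{\varrho_D,K}>0$, depending only on $K$ and $\varrho_D$, such that for all integers $m\ge2$ $$g_m(\mathrm{Id})\le C_{\varrho_D,K}\,\min\Big\{a_{\lfloor m/(c_6\log m)\rfloor}(\mathrm{Id}),\ \sqrt{\log m}\;a_{\lfloor c_5m\rfloor}(\mathrm{Id})\Big\},$$ where $\mathrm{Id}\colon H(K)\to\ell_\infty(D)$ is the embedding.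
   Context: $\log$ is the natural logarithm; $\|f\|_{\ell_\infty(D)}=\sup_{x\in D}|f(x)|$. For a normed space $F$ of functions on $D$: approximation numbers $a_n(\mathrm{Id}\colon H(K)\to F):=\inf\{\sup_{\|f\|_{H(K)}\le1}\|f-Af\|_F:\ A\colon H(K)\to F \text{ linear continuous},\ \operatorname{rank}A<n\}$ (with $a_0=\inf\emptyset=+\infty$); sampling numbers $g_n(\mathrm{Id}\colon H(K)\to F):=\inf_{x^1,\dots,x^n\in D}\inf_{R}\sup_{\|f\|_{H(K)}\le1}\|f-R(f(x^1),\dots,f(x^n))\|_F$, where $R$ runs over linear maps $\mathbb C^n\to F$. Christoffel function: the embedding $J\colon H(K)\to L_2(D,\varrho_D)$ is compact. Let $\lambda_1\ge\lambda_2\ge\dots>0$ be the eigenvalues of $J^*J$, $\sigma_k=\sqrt{\lambda_k}$, $(e_k^* )_{k\ge1}$ a corresponding $H(K)$-orthonormal system of eigenfunctions, and $\eta_k:=\sigma_k^{-1}e_k^*$ (pointwise defined), which is orthonormal in $L_2(D,\varrho_D)$. Then $N_{K,\varrho_D}(m):=\sup_{x\in D}\sum_{k=1}^{m-1}|\eta_k(x)|^2$. *)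

theory Defs
  imports "HOL-Analysis.Analysis" "HOL-Library.Function_Algebras" "HOL-Library.Landau_Symbols"
begin

section \<open>Complex vector spaces of functions\<close>

text \<open>
  A complex function on a set \<open>D\<close> is represented by the total function that vanishes off \<open>D\<close>, so that
  spaces of functions on \<open>D\<close> are subspaces of \<open>'a \<Rightarrow> complex\<close>.  The coordinate space of complex
  \<open>n\<close>-vectors is treated in the same way, with \<open>{..<n}\<close> in the role of \<open>D\<close>.
\<close>

definition fscale :: "complex \<Rightarrow> ('a \<Rightarrow> complex) \<Rightarrow> 'a \<Rightarrow> complex" where
  "fscale c f = (\<lambda>x. c * f x)"

interpretation cfun: vector_space fscale
  by unfold_locales (auto simp: fscale_def fun_eq_iff algebra_simps)

definition funs_on :: "'a set \<Rightarrow> ('a \<Rightarrow> complex) set" where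
  "funs_on D = {f. \<forall>x. x \<notin> D \<longrightarrow> f x = 0}"

definition clinear_map ::
  "('a \<Rightarrow> complex) set \<Rightarrow> ('b \<Rightarrow> complex) set \<Rightarrow> (('a \<Rightarrow> complex) \<Rightarrow> 'b \<Rightarrow> complex) \<Rightarrow> bool" where
  "clinear_map V W T \<longleftrightarrow>
     (\<forall>u\<in>V. T u \<in> W) \<and>
     (\<forall>u\<in>V. \<forall>v\<in>V. T (u + v) = T u + T v) \<and>
     (\<forall>c. \<forall>u\<in>V. T (fscale c u) = fscale c (T u))"

text \<open>The library's \<open>dim\<close> is 0 on infinite-dimensional sets, so finiteness is always stated separately.\<close>

definition finite_dim :: "('a \<Rightarrow> complex) set \<Rightarrow> bool" where
  "finite_dim V \<longleftrightarrow> (\<exists>B. finite B \<and> V \<subseteq> cfun.span B)"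


section \<open>Reproducing kernel Hilbert spaces\<close>

definition hermitian_kernel :: "'a set \<Rightarrow> ('a \<Rightarrow> 'a \<Rightarrow> complex) \<Rightarrow> bool" where
  "hermitian_kernel D K \<longleftrightarrow> (\<forall>x\<in>D. \<forall>y\<in>D. K x y = cnj (K y x))"

text \<open>
  Positive definiteness in the sense of Aronszajn (the quadratic form may vanish at nonzero
  coefficients).  For a Hermitian kernel the double sum is real.
\<close>

definition positive_definite_kernel :: "'a set \<Rightarrow> ('a \<Rightarrow> 'a \<Rightarrow> complex) \<Rightarrow> bool" where
  "positive_definite_kernel D K \<longleftrightarrow>
     (\<forall>X c. finite X \<longrightarrow> X \<subseteq> D \<longrightarrow> 0 \<le> Re (\<Sum>x\<in>X. \<Sum>y\<in>X. c x * cnj (c y) * K x y))"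

definition hnorm :: "(('a \<Rightarrow> complex) \<Rightarrow> ('a \<Rightarrow> complex) \<Rightarrow> complex) \<Rightarrow> ('a \<Rightarrow> complex) \<Rightarrow> real" where
  "hnorm ip f = sqrt (Re (ip f f))"

definition kernel_section :: "'a set \<Rightarrow> ('a \<Rightarrow> 'a \<Rightarrow> complex) \<Rightarrow> 'a \<Rightarrow> 'a \<Rightarrow> complex" where
  "kernel_section D K x = (\<lambda>y. if y \<in> D then K y x else 0)"

text \<open>
  \<open>rkhs D K H ip\<close>: the set \<open>H\<close> with inner product \<open>ip\<close> (linear in the first argument) is a Hilbert
  space of functions on \<open>D\<close> with reproducing kernel \<open>K\<close>.  By the Moore-Aronszajn theorem, a Hermitian
  positive definite \<open>K\<close> has exactly one such \<open>H\<close>, with \<open>ip\<close> uniquely determined on \<open>H\<close>.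
\<close>

locale rkhs =
  fixes D :: "'a set"
    and K :: "'a \<Rightarrow> 'a \<Rightarrow> complex"
    and H :: "('a \<Rightarrow> complex) set"
    and ip :: "('a \<Rightarrow> complex) \<Rightarrow> ('a \<Rightarrow> complex) \<Rightarrow> complex"
  assumes vanish_off: "H \<subseteq> funs_on D"
    and subspace: "cfun.subspace H"
    and ip_add: "\<lbrakk>f \<in> H; g \<in> H; h \<in> H\<rbrakk> \<Longrightarrow> ip (f + g) h = ip f h + ip g h"
    and ip_scale: "\<lbrakk>f \<in> H; g \<in> H\<rbrakk> \<Longrightarrow> ip (fscale c f) g = c * ip f g"
    and ip_cnj: "\<lbrakk>f \<in> H; g \<in> H\<rbrakk> \<Longrightarrow> ip f g = cnj (ip g f)"
    and ip_nonneg: "f \<in> H \<Longrightarrow> 0 \<le> Re (ip f f)"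
    and ip_definite: "\<lbrakk>f \<in> H; ip f f = 0\<rbrakk> \<Longrightarrow> f = 0"
    and complete:
      "\<lbrakk>\<And>n. s n \<in> H; \<And>\<epsilon>. 0 < \<epsilon> \<Longrightarrow> \<exists>N. \<forall>m\<ge>N. \<forall>n\<ge>N. hnorm ip (s m - s n) < \<epsilon>\<rbrakk>
        \<Longrightarrow> \<exists>f\<in>H. (\<lambda>n. hnorm ip (s n - f)) \<longlonglongrightarrow> 0"
    and section_mem: "x \<in> D \<Longrightarrow> kernel_section D K x \<in> H"
    and reproducing: "\<lbrakk>f \<in> H; x \<in> D\<rbrakk> \<Longrightarrow> f x = ip f (kernel_section D K x)"


section \<open>Approximation and sampling numbers\<close>

definition linf :: "'a set \<Rightarrow> ('a \<Rightarrow> complex) set" where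
  "linf D = {f \<in> funs_on D. bounded (f ` D)}"

definition linf_norm :: "'a set \<Rightarrow> ('a \<Rightarrow> complex) \<Rightarrow> real" where
  "linf_norm D f = (SUP x\<in>D. cmod (f x))"

definition cont_op ::
  "('a \<Rightarrow> complex) set \<Rightarrow> (('a \<Rightarrow> complex) \<Rightarrow> real) \<Rightarrow> (('a \<Rightarrow> complex) \<Rightarrow> real) \<Rightarrow>
    (('a \<Rightarrow> complex) \<Rightarrow> 'a \<Rightarrow> complex) \<Rightarrow> bool" where
  "cont_op H nH nF A \<longleftrightarrow>
     (\<forall>f\<in>H. \<forall>\<epsilon>>0. \<exists>\<delta>>0. \<forall>g\<in>H. nH (g - f) < \<delta> \<longrightarrow> nF (A g - A f) < \<epsilon>)"

definition worst_case_error ::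
  "('a \<Rightarrow> complex) set \<Rightarrow> (('a \<Rightarrow> complex) \<Rightarrow> real) \<Rightarrow> (('a \<Rightarrow> complex) \<Rightarrow> real) \<Rightarrow>
    (('a \<Rightarrow> complex) \<Rightarrow> 'a \<Rightarrow> complex) \<Rightarrow> ennreal" where
  "worst_case_error H nH nF A = (SUP f\<in>{f \<in> H. nH f \<le> 1}. ennreal (nF (f - A f)))"

text \<open>
  In both definitions \<open>H\<close> and \<open>F\<close> are spaces of functions on \<open>D\<close> with norms \<open>nH\<close> and \<open>nF\<close>.
  For \<open>n = 0\<close> the first infimum is over the empty set, hence \<open>\<infinity>\<close>.
\<close>

definition approx_number ::
  "('a \<Rightarrow> complex) set \<Rightarrow> (('a \<Rightarrow> complex) \<Rightarrow> real) \<Rightarrow> ('a \<Rightarrow> complex) set \<Rightarrow>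
    (('a \<Rightarrow> complex) \<Rightarrow> real) \<Rightarrow> nat \<Rightarrow> ennreal" where
  "approx_number H nH F nF n =
     (INF A\<in>{A. clinear_map H F A \<and> cont_op H nH nF A \<and>
                finite_dim (A ` H) \<and> cfun.dim (A ` H) < n}.
        worst_case_error H nH nF A)"

definition sample :: "nat \<Rightarrow> (nat \<Rightarrow> 'a) \<Rightarrow> ('a \<Rightarrow> complex) \<Rightarrow> nat \<Rightarrow> complex" where
  "sample n x f = (\<lambda>i. if i < n then f (x i) else 0)"

definition sampling_number ::
  "'a set \<Rightarrow> ('a \<Rightarrow> complex) set \<Rightarrow> (('a \<Rightarrow> complex) \<Rightarrow> real) \<Rightarrow> ('a \<Rightarrow> complex) set \<Rightarrow>
    (('a \<Rightarrow> complex) \<Rightarrow> real) \<Rightarrow> nat \<Rightarrow> ennreal" where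
  "sampling_number D H nH F nF n =
     (INF x\<in>{x. \<forall>i<n. x i \<in> D}. INF R\<in>{R. clinear_map (funs_on {..<n}) F R}.
        worst_case_error H nH nF (\<lambda>f. R (sample n x f)))"


section \<open>Christoffel function\<close>

definition l2_ip :: "'a measure \<Rightarrow> ('a \<Rightarrow> complex) \<Rightarrow> ('a \<Rightarrow> complex) \<Rightarrow> complex" where
  "l2_ip M f g = (\<integral>x. f x * cnj (g x) \<partial>M)"

text \<open>The adjoint of the embedding \<open>J\<close> of \<open>H\<close> into \<open>L\<^sub>2(M)\<close>.\<close>

definition embedding_adjoint ::
  "('a \<Rightarrow> complex) set \<Rightarrow> (('a \<Rightarrow> complex) \<Rightarrow> ('a \<Rightarrow> complex) \<Rightarrow> complex) \<Rightarrow> 'a measure \<Rightarrow>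
    ('a \<Rightarrow> complex) \<Rightarrow> 'a \<Rightarrow> complex" where
  "embedding_adjoint H ip M u = (THE h. h \<in> H \<and> (\<forall>g\<in>H. ip g h = l2_ip M g u))"

text \<open>
  Since \<open>J f = f\<close> as a function, \<open>embedding_adjoint H ip M f\<close> is \<open>J\<^sup>*J f\<close> for \<open>f \<in> H\<close>.
  The last condition says that \<open>lam\<close> lists all nonzero eigenvalues of \<open>J\<^sup>*J\<close> with multiplicity and that
  the \<open>e k\<close> are corresponding eigenfunctions.  Indices start at 1; \<open>lam 0\<close> and \<open>e 0\<close> are irrelevant.
\<close>

definition eigensystem ::
  "('a \<Rightarrow> complex) set \<Rightarrow> (('a \<Rightarrow> complex) \<Rightarrow> ('a \<Rightarrow> complex) \<Rightarrow> complex) \<Rightarrow> 'a measure \<Rightarrow>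
    (nat \<Rightarrow> real) \<Rightarrow> (nat \<Rightarrow> 'a \<Rightarrow> complex) \<Rightarrow> bool" where
  "eigensystem H ip M lam e \<longleftrightarrow>
     (\<forall>k\<ge>1. 0 < lam k \<and> lam (Suc k) \<le> lam k) \<and>
     (\<forall>k\<ge>1. e k \<in> H) \<and>
     (\<forall>j\<ge>1. \<forall>k\<ge>1. ip (e j) (e k) = (if j = k then 1 else 0)) \<and>
     (\<forall>\<mu>. \<mu> \<noteq> 0 \<longrightarrow>
        {f \<in> H. embedding_adjoint H ip M f = fscale \<mu> f} =
        cfun.span {e k |k. 1 \<le> k \<and> complex_of_real (lam k) = \<mu>})"

definition christoffel ::
  "'a set \<Rightarrow> (nat \<Rightarrow> real) \<Rightarrow> (nat \<Rightarrow> 'a \<Rightarrow> complex) \<Rightarrow> nat \<Rightarrow> real" where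
  "christoffel D lam e m =
     (SUP x\<in>D. \<Sum>k\<in>{1..<m}. (cmod (e k x / complex_of_real (sqrt (lam k))))\<^sup>2)"


section \<open>Borel measures of full support\<close>

definition finite_borel_measure_on :: "'a::topological_space set \<Rightarrow> 'a measure \<Rightarrow> bool" where
  "finite_borel_measure_on D M \<longleftrightarrow> finite_measure M \<and> sets M = sets (restrict_space borel D)"

definition full_support :: "'a::topological_space set \<Rightarrow> 'a measure \<Rightarrow> bool" where
  "full_support D M \<longleftrightarrow> (\<forall>U. open U \<longrightarrow> U \<inter> D \<noteq> {} \<longrightarrow> 0 < emeasure M (U \<inter> D))"

text \<open>
  For constants that are uniform in the dimension \<open>d\<close>, real \<open>d\<close>-space has to be a subset of one type.
  The library's \<open>Euclidean_space d\<close> is the set of \<open>x :: nat \<Rightarrow> real\<close> with \<open>x i = 0\<close> for \<open>i \<ge> d\<close>, with the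
  subspace topology of the (type class) product topology on \<open>nat \<Rightarrow> real\<close>.  Hence compactness, continuity
  and Borel sets of \<open>D \<subseteq> topspace (Euclidean_space d)\<close> may be taken in \<open>nat \<Rightarrow> real\<close>.
\<close>

end

theory Submission
  imports Defs
begin

text \<open>
  The sampling points \<open>x\<^sub>1, \<dots>, x\<^sub>m\<close> are chosen so that the kernel sections \<open>K\<^sub>x\<close> at these points span a
  parallelepiped of almost maximal volume in \<open>H\<close>.  Let \<open>s\<close> be the distance of \<open>K\<^sub>x\<close> from
  \<open>span {K\<^sub>x\<^sub>1, \<dots>}\<close>, which is the pointwise error of interpolation at \<open>x\<close>.  By maximality, each of the
  \<open>m + 1\<close> sections obtained by adding \<open>x\<close> has distance at least \<open>s / 2\<close> from the span of the others, so
  their dual basis has norms at most \<open>2 / s\<close>.  If \<open>A\<close> has rank \<open>r\<close> and error \<open>e\<close>, let \<open>P\<close> be the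
  projection onto \<open>ker A\<close> within the span of all \<open>m + 1\<close> sections.  Then \<open>\<parallel>P K\<^sub>y\<parallel> \<le> e\<close>, and
  computing the trace of \<open>P\<close> in this basis gives \<open>m + 1 - r \<le> (m + 1) (2 / s) e\<close>.  Hence
  \<open>g\<^sub>m \<le> 4 a\<^sub>n\<close> whenever \<open>2 n \<le> m\<close>, which contains both bounds of the theorem.
\<close>

section \<open>Linear algebra\<close>

lemma sum_fun_apply: "(\<Sum>i\<in>I. f i) x = (\<Sum>i\<in>I. f i x)"
  for f :: "'i \<Rightarrow> 'a \<Rightarrow> 'b::comm_monoid_add"
  by (induction I rule: infinite_finite_induct) auto

lemma fscale_apply [simp]: "fscale c f x = c * f x"
  by (simp add: fscale_def)

lemma clinear_map_sum:
  assumes "clinear_map V W T" "cfun.subspace V" "finite I" "\<And>i. i \<in> I \<Longrightarrow> f i \<in> V"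
  shows "T (\<Sum>i\<in>I. fscale (c i) (f i)) = (\<Sum>i\<in>I. fscale (c i) (T (f i)))"
  using assms(3,4)
proof (induction I rule: finite_induct)
  case empty
  have "T (fscale 0 0) = fscale 0 (T 0)"
    using assms(1) cfun.subspace_0[OF assms(2)] unfolding clinear_map_def by blast
  then show ?case by (simp add: zero_fun_def)
next
  case (insert i I)
  have "fscale (c i) (f i) \<in> V" "(\<Sum>i\<in>I. fscale (c i) (f i)) \<in> V"
    using insert.prems assms(2) by (auto intro!: cfun.subspace_sum cfun.subspace_scale)
  then have "T (fscale (c i) (f i) + (\<Sum>i\<in>I. fscale (c i) (f i))) =
      fscale (c i) (T (f i)) + T (\<Sum>i\<in>I. fscale (c i) (f i))"
    using assms(1) insert.prems unfolding clinear_map_def by auto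
  also have "T (\<Sum>i\<in>I. fscale (c i) (f i)) = (\<Sum>i\<in>I. fscale (c i) (T (f i)))"
    using insert by blast
  finally show ?case
    unfolding sum.insert[OF insert.hyps] .
qed

text \<open>Gaussian elimination by induction on the equations. The solutions found here supply
  vectors in the kernel of an operator that are orthogonal to given ones.\<close>

lemma homogeneous_system_nontrivial_solution:
  fixes a :: "'i \<Rightarrow> 'j \<Rightarrow> 'b::field"
  assumes "finite J" "finite I" "card J < card I"
  shows "\<exists>c. (\<exists>i\<in>I. c i \<noteq> 0) \<and> (\<forall>j\<in>J. (\<Sum>i\<in>I. c i * a i j) = 0)"
  using assms
proof (induction J arbitrary: I a rule: finite_induct)
  case empty
  then have "I \<noteq> {}" by auto
  then show ?case by (intro exI[of _ "\<lambda>_. 1"]) auto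
next
  case (insert j J)
  show ?case
  proof (cases "\<forall>i\<in>I. a i j = 0")
    case True
    have "card J < card I" using insert by simp
    from insert.IH[OF insert.prems(1) this, of a] True show ?thesis by auto
  next
    case False
    then obtain p where p: "p \<in> I" "a p j \<noteq> 0" by auto
    define I' where "I' = I - {p}"
    have fin: "finite I'" and "card J < card I'"
      using insert p by (auto simp: I'_def)
    \<comment> \<open>These are the coefficients of the remaining equations after equation
      \<open>j\<close> is solved for the unknown with pivot \<open>a p j\<close>.\<close>
    from insert.IH[OF this, of "\<lambda>i l. a i l - a i j / a p j * a p l"]
    obtain c where c: "\<exists>i\<in>I'. c i \<noteq> 0"
      "\<And>l. l \<in> J \<Longrightarrow> (\<Sum>i\<in>I'. c i * (a i l - a i j / a p j * a p l)) = 0" by auto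
    define s where "s = - (\<Sum>i\<in>I'. c i * a i j) / a p j"
    define c' where "c' = c(p := s)"
    have split: "(\<Sum>i\<in>I. c' i * a i l) = s * a p l + (\<Sum>i\<in>I'. c i * a i l)" for l
      using p insert.prems(1) by (simp add: sum.remove[of I p] I'_def c'_def)
    have "(\<Sum>i\<in>I. c' i * a i j) = 0"
      unfolding split s_def using p by simp
    moreover have "(\<Sum>i\<in>I. c' i * a i l) = 0" if "l \<in> J" for l
      using c(2)[OF that] unfolding split s_def
      by (simp add: algebra_simps sum_subtractf sum_distrib_left sum_distrib_right sum_divide_distrib)
    moreover have "\<exists>i\<in>I. c' i \<noteq> 0"
      using c(1) by (auto simp: c'_def I'_def)
    ultimately show ?thesis by auto
  qed
qed

section \<open>Residuals of kernel sections\<close>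

context rkhs
begin

section \<open>Inner product calculus in \<open>H\<close>\<close>

abbreviation nrm :: "('a \<Rightarrow> complex) \<Rightarrow> real" where
  "nrm \<equiv> hnorm ip"

abbreviation ksec :: "'a \<Rightarrow> 'a \<Rightarrow> complex" where
  "ksec \<equiv> kernel_section D K"

lemmas mem_simps =
  cfun.subspace_0[OF subspace] cfun.subspace_add[OF subspace] cfun.subspace_diff[OF subspace]
  cfun.subspace_scale[OF subspace] cfun.subspace_sum[OF subspace] section_mem

lemma ip_add_right: "\<lbrakk>f \<in> H; g \<in> H; h \<in> H\<rbrakk> \<Longrightarrow> ip h (f + g) = ip h f + ip h g"
  by (metis ip_add ip_cnj mem_simps(2) complex_cnj_add)

lemma ip_scale_right: "\<lbrakk>f \<in> H; g \<in> H\<rbrakk> \<Longrightarrow> ip f (fscale c g) = cnj c * ip f g"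
  by (metis ip_scale ip_cnj mem_simps(4) complex_cnj_mult)

lemma ip_diff: "\<lbrakk>f \<in> H; g \<in> H; h \<in> H\<rbrakk> \<Longrightarrow> ip (f - g) h = ip f h - ip g h"
  using ip_add[of "f - g" g h] by (simp add: mem_simps)

lemma ip_diff_right: "\<lbrakk>f \<in> H; g \<in> H; h \<in> H\<rbrakk> \<Longrightarrow> ip h (f - g) = ip h f - ip h g"
  using ip_add_right[of "f - g" g h] by (simp add: mem_simps)

lemma ip_0_left [simp]: "f \<in> H \<Longrightarrow> ip 0 f = 0"
  using ip_scale[of 0 f 0] by (simp add: mem_simps)

lemma ip_0_right [simp]: "f \<in> H \<Longrightarrow> ip f 0 = 0"
  by (metis ip_cnj ip_0_left mem_simps(1) complex_cnj_zero)

lemma ip_sum: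
  assumes "finite I" "\<And>i. i \<in> I \<Longrightarrow> f i \<in> H" "g \<in> H"
  shows "ip (\<Sum>i\<in>I. fscale (c i) (f i)) g = (\<Sum>i\<in>I. c i * ip (f i) g)"
  using assms by (induction I rule: finite_induct) (simp_all add: ip_add ip_scale mem_simps)

lemma ip_sum_right:
  assumes "finite I" "\<And>i. i \<in> I \<Longrightarrow> f i \<in> H" "g \<in> H"
  shows "ip g (\<Sum>i\<in>I. fscale (c i) (f i)) = (\<Sum>i\<in>I. cnj (c i) * ip g (f i))"
  using assms by (induction I rule: finite_induct) (simp_all add: ip_add_right ip_scale_right mem_simps)

lemma nrm_nonneg: "f \<in> H \<Longrightarrow> 0 \<le> nrm f"
  by (simp add: hnorm_def ip_nonneg)

lemma nrm_sq: "f \<in> H \<Longrightarrow> (nrm f)\<^sup>2 = Re (ip f f)"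
  by (simp add: hnorm_def ip_nonneg)

lemma ip_self: "f \<in> H \<Longrightarrow> ip f f = complex_of_real ((nrm f)\<^sup>2)"
proof -
  assume f: "f \<in> H"
  have "Im (ip f f) = 0" using arg_cong[OF ip_cnj[OF f f], of Im] by simp
  then show ?thesis by (simp add: nrm_sq f complex_eq_iff)
qed

lemma nrm_eq_0: "\<lbrakk>f \<in> H; nrm f = 0\<rbrakk> \<Longrightarrow> f = 0"
  using ip_definite ip_self by fastforce

lemma nrm_scale: "f \<in> H \<Longrightarrow> nrm (fscale c f) = cmod c * nrm f"
proof -
  assume f: "f \<in> H"
  have "ip (fscale c f) (fscale c f) = (c * cnj c) * ip f f"
    using f by (simp add: ip_scale ip_scale_right mem_simps)
  also have "\<dots> = complex_of_real ((cmod c)\<^sup>2 * (nrm f)\<^sup>2)"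
    using f by (simp only: complex_norm_square[symmetric] ip_self of_real_mult)
  finally show ?thesis
    using f by (simp add: hnorm_def[of ip "fscale c f"] real_sqrt_mult nrm_nonneg)
qed

lemma cauchy_schwarz:
  assumes "f \<in> H" "g \<in> H"
  shows "cmod (ip f g) \<le> nrm f * nrm g"
proof (cases "g = 0")
  case True
  then show ?thesis using assms by (simp add: hnorm_def)
next
  case False
  then have g: "nrm g \<noteq> 0" using assms nrm_eq_0 by auto
  define G where "G = complex_of_real ((nrm g)\<^sup>2)"
  have G: "G \<noteq> 0" "cnj G = G" "ip g g = G" using g assms by (simp_all add: G_def ip_self)
  \<comment> \<open>The part of \<open>f\<close> orthogonal to \<open>g\<close>; the inequality is
    the nonnegativity of its squared norm.\<close>
  define h where "h = f - fscale (ip f g / G) g"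
  have h: "h \<in> H" using assms by (simp add: h_def mem_simps)
  have gf: "ip g f = cnj (ip f g)" by (rule ip_cnj[OF assms(2,1)])
  have "ip h h = ip f f - ip f g * cnj (ip f g) / G"
    unfolding h_def using assms G(1)
    by (simp add: ip_diff ip_diff_right ip_scale ip_scale_right mem_simps gf G(2,3))
  also have "\<dots> = complex_of_real ((nrm f)\<^sup>2 - (cmod (ip f g))\<^sup>2 / (nrm g)\<^sup>2)"
    using assms by (simp add: ip_self G_def complex_norm_square[symmetric])
  finally have "0 \<le> (nrm f)\<^sup>2 - (cmod (ip f g))\<^sup>2 / (nrm g)\<^sup>2"
    using ip_nonneg[OF h] by simp
  then have "(cmod (ip f g))\<^sup>2 \<le> (nrm f * nrm g)\<^sup>2"
    using g by (simp add: field_simps power_mult_distrib)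
  then show ?thesis
    by (rule power2_le_imp_le) (intro mult_nonneg_nonneg nrm_nonneg assms)
qed

section \<open>Functions vanishing at nodes, and Gram-Schmidt\<close>

lemma span_sections_subset: "X \<subseteq> D \<Longrightarrow> cfun.span (ksec ` X) \<subseteq> H"
  using subspace section_mem by (intro cfun.span_minimal) auto

text \<open>By the reproducing property a zero of \<open>f\<close> at \<open>y\<close> is
  orthogonality to the section at \<open>y\<close>, and the orthogonal complement of
  \<open>f\<close> is a subspace.\<close>

lemma vanishing_orthogonal_span:
  assumes "X \<subseteq> D" "f \<in> H" "\<And>y. y \<in> X \<Longrightarrow> f y = 0" "g \<in> cfun.span (ksec ` X)"
  shows "ip f g = 0"
proof -
  have "cfun.span (ksec ` X) \<subseteq> {g \<in> H. ip f g = 0}"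
  proof (rule cfun.span_minimal)
    show "ksec ` X \<subseteq> {g \<in> H. ip f g = 0}"
    proof safe
      fix y assume y: "y \<in> X"
      then have "y \<in> D" using assms(1) by blast
      then show "ksec y \<in> H" "ip f (ksec y) = 0"
        using assms(3)[OF y] reproducing[OF assms(2)] section_mem by auto
    qed
    show "cfun.subspace {g \<in> H. ip f g = 0}"
      unfolding cfun.subspace_def using assms(2) by (simp add: mem_simps ip_add_right ip_scale_right)
  qed
  then show ?thesis using assms(4) by blast
qed

lemma vanishing_in_span_eq_0:
  assumes "X \<subseteq> D" "\<And>y. y \<in> X \<Longrightarrow> f y = 0" "f \<in> cfun.span (ksec ` X)"
  shows "f = 0"
  using assms span_sections_subset vanishing_orthogonal_span[of X f f] ip_definite by blast

text \<open>The component of \<open>ksec x\<close> orthogonal to the sections at \<open>X\<close>,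
  with orthogonality encoded as vanishing on \<open>X\<close>. Its norm is the distance to their
  span, known as the power function.\<close>

definition is_residual :: "'a set \<Rightarrow> 'a \<Rightarrow> ('a \<Rightarrow> complex) \<Rightarrow> bool" where
  "is_residual X x r \<longleftrightarrow> r \<in> H \<and> (\<forall>y\<in>X. r y = 0) \<and> ksec x - r \<in> cfun.span (ksec ` X)"

lemma is_residual_unique:
  assumes "X \<subseteq> D" "is_residual X x r" "is_residual X x r'"
  shows "r = r'"
proof -
  have "r' - r = (ksec x - r) - (ksec x - r')" by simp
  then have "r' - r \<in> cfun.span (ksec ` X)"
    using assms cfun.span_diff unfolding is_residual_def by metis
  then have "r' - r = 0"
    using assms by (intro vanishing_in_span_eq_0[of X]) (auto simp: is_residual_def)
  then show ?thesis by simp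
qed

text \<open>\<open>ksec x\<close> and \<open>r\<close> differ by an element of the span, to which
  \<open>f\<close> is orthogonal. So \<open>r\<close> represents evaluation at \<open>x\<close> on
  the functions vanishing on \<open>X\<close>.\<close>

lemma is_residual_ip:
  assumes "X \<subseteq> D" "x \<in> D" "is_residual X x r" "f \<in> H" "\<And>y. y \<in> X \<Longrightarrow> f y = 0"
  shows "ip f r = f x"
proof -
  have "ip f (ksec x - r) = 0"
    using assms by (intro vanishing_orthogonal_span[of X]) (auto simp: is_residual_def)
  then show ?thesis
    using assms by (simp add: ip_diff_right mem_simps reproducing is_residual_def)
qed

text \<open>One Gram-Schmidt step: \<open>q a / p a\<close> equals \<open>ip q p / ip p p\<close>,
  so the component of \<open>q\<close> along \<open>p\<close> is removed.\<close>

lemma is_residual_insert: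
  assumes XD: "X \<subseteq> D" and D: "a \<in> D" "b \<in> D"
    and p: "is_residual X a p" and q: "is_residual X b q"
  shows "is_residual (insert a X) b (q - fscale (q a / p a) p)"
proof -
  have H: "p \<in> H" "q \<in> H" using p q by (auto simp: is_residual_def)
  have pp: "p a = complex_of_real ((nrm p)\<^sup>2)"
    using is_residual_ip[OF XD D(1) p H(1)] p ip_self[OF H(1)] by (auto simp: is_residual_def)
  have qa: "q a = ip q p"
    using is_residual_ip[OF XD D(1) p H(2)] q by (auto simp: is_residual_def)
  \<comment> \<open>In the degenerate case \<open>p a = 0\<close> the quotient is 0 by convention;
    then \<open>p = 0\<close>, so that \<open>q a = ip q p\<close> vanishes as well.\<close>
  have 1: "q a - q a / p a * p a = 0"
  proof (cases "p a = 0")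
    case True
    then have "p = 0" using pp H nrm_eq_0 by auto
    then show ?thesis using qa H by simp
  qed simp
  have sub: "cfun.span (ksec ` X) \<subseteq> cfun.span (ksec ` insert a X)"
    by (intro cfun.span_mono) auto
  have "ksec a \<in> cfun.span (ksec ` insert a X)" by (simp add: cfun.span_base)
  moreover have "ksec a - p \<in> cfun.span (ksec ` insert a X)"
    using p sub by (auto simp: is_residual_def)
  ultimately have "ksec a - (ksec a - p) \<in> cfun.span (ksec ` insert a X)"
    by (rule cfun.span_diff)
  then have "(ksec b - q) + fscale (q a / p a) p \<in> cfun.span (ksec ` insert a X)"
    using q sub by (intro cfun.span_add cfun.span_scale) (auto simp: is_residual_def)
  moreover have "ksec b - (q - fscale (q a / p a) p) = (ksec b - q) + fscale (q a / p a) p"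
    by simp
  ultimately have "ksec b - (q - fscale (q a / p a) p) \<in> cfun.span (ksec ` insert a X)"
    by metis
  then show ?thesis
    unfolding is_residual_def using p q 1 H by (auto simp: is_residual_def mem_simps)
qed

lemma is_residual_exists:
  assumes "finite X" "X \<subseteq> D" "x \<in> D"
  shows "\<exists>r. is_residual X x r"
  using assms
proof (induction X arbitrary: x rule: finite_induct)
  case empty
  then show ?case by (intro exI[of _ "ksec x"]) (auto simp: is_residual_def section_mem)
next
  case (insert a X)
  then show ?case using is_residual_insert by (metis insert_subset)
qed

section \<open>Norms of residuals\<close>

definition residual :: "'a set \<Rightarrow> 'a \<Rightarrow> 'a \<Rightarrow> complex" where
  "residual X x = (SOME r. is_residual X x r)"

lemma is_residual_residual:
  "\<lbrakk>finite X; X \<subseteq> D; x \<in> D\<rbrakk> \<Longrightarrow> is_residual X x (residual X x)"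
  unfolding residual_def by (rule someI_ex[OF is_residual_exists])

lemma
  assumes "finite X" "X \<subseteq> D" "x \<in> D"
  shows residual_mem: "residual X x \<in> H"
    and residual_vanish: "\<And>y. y \<in> X \<Longrightarrow> residual X x y = 0"
    and residual_span: "ksec x - residual X x \<in> cfun.span (ksec ` X)"
  using is_residual_residual[OF assms] by (auto simp: is_residual_def)

lemma residual_ip:
  assumes "finite X" "X \<subseteq> D" "x \<in> D" "f \<in> H" "\<And>y. y \<in> X \<Longrightarrow> f y = 0"
  shows "ip f (residual X x) = f x"
  by (rule is_residual_ip[OF assms(2,3) is_residual_residual[OF assms(1-3)] assms(4,5)])

lemma residual_self:
  assumes "finite X" "X \<subseteq> D" "x \<in> D"
  shows "residual X x x = complex_of_real ((nrm (residual X x))\<^sup>2)"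
  using residual_ip[OF assms residual_mem[OF assms] residual_vanish[OF assms]]
    ip_self[OF residual_mem[OF assms]] by simp

text \<open>The residual for \<open>Y\<close> also vanishes on \<open>X\<close>, so its inner
  product with the residual for \<open>X\<close> is its value at \<open>x\<close>, which is its own
  squared norm. Cauchy-Schwarz finishes.\<close>

lemma nrm_residual_antimono:
  assumes "finite Y" "X \<subseteq> Y" "Y \<subseteq> D" "x \<in> D"
  shows "nrm (residual Y x) \<le> nrm (residual X x)"
proof -
  have X: "finite X" "X \<subseteq> D" and x: "x \<in> D" using assms by (auto intro: finite_subset)
  have Y: "finite Y" "Y \<subseteq> D" using assms by auto
  let ?r = "residual Y x"
  have m: "?r \<in> H" "residual X x \<in> H" using residual_mem[OF Y x] residual_mem[OF X x] by auto
  have "ip ?r (residual X x) = ?r x"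
    using residual_vanish[OF Y x] assms(2) by (intro residual_ip X x m) auto
  then have "(nrm ?r)\<^sup>2 \<le> nrm ?r * nrm (residual X x)"
    using cauchy_schwarz[OF m] residual_self[OF Y x] by (simp add: norm_power)
  then show ?thesis
    using nrm_nonneg[OF m(1)] nrm_nonneg[OF m(2)]
    by (cases "nrm ?r = 0") (auto simp: power2_eq_square mult_le_cancel_left)
qed

lemma nrm_residual_le:
  assumes "finite X" "X \<subseteq> D" "x \<in> D"
  shows "nrm (residual X x) \<le> sqrt (Re (K x x))"
proof -
  have "residual {} x = ksec x"
    using is_residual_unique[of "{}" x] is_residual_residual[of "{}" x] assms
    by (auto simp: is_residual_def section_mem)
  moreover have "ip (ksec x) (ksec x) = K x x"
    using reproducing[OF section_mem, of x x] assms by (simp add: kernel_section_def)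
  ultimately show ?thesis
    using nrm_residual_antimono[of X "{}" x] assms by (simp add: hnorm_def)
qed

text \<open>The right side is the Gram determinant of the residuals of \<open>a\<close> and
  \<open>b\<close> over \<open>X\<close>. The common factor on the left avoids a division and covers
  a vanishing residual of \<open>a\<close>.\<close>

lemma nrm_residual_insert:
  assumes "finite X" "X \<subseteq> D" "a \<in> D" "b \<in> D"
  shows "(nrm (residual X a))\<^sup>2 * (nrm (residual (insert a X) b))\<^sup>2 =
    (nrm (residual X a))\<^sup>2 * (nrm (residual X b))\<^sup>2 - (cmod (residual X a b))\<^sup>2"
proof -
  define p q where pq: "p = residual X a" "q = residual X b"
  have H: "p \<in> H" "q \<in> H" using assms residual_mem by (auto simp: pq)
  have eq: "residual (insert a X) b = q - fscale (q a / p a) p"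
    using assms is_residual_insert[of X a b p q] is_residual_residual
      is_residual_unique[of "insert a X" b] by (simp add: pq)
  have pb: "p b = ip p q"
    using residual_ip[OF assms(1,2,4) H(1)] residual_vanish[OF assms(1-3)] by (simp add: pq)
  have qa: "q a = ip q p"
    using residual_ip[OF assms(1,2,3) H(2)] residual_vanish[OF assms(1,2,4)] by (simp add: pq)
  have pa: "p a = complex_of_real ((nrm p)\<^sup>2)" and qb: "q b = complex_of_real ((nrm q)\<^sup>2)"
    using assms by (simp_all add: pq residual_self)
  have qp: "q a = cnj (p b)" using pb qa ip_cnj[OF H(2,1)] by simp
  have "complex_of_real ((nrm (residual (insert a X) b))\<^sup>2) = q b - q a / p a * p b"
    using assms residual_self[of "insert a X" b] eq by simp
  then have "p a * complex_of_real ((nrm (residual (insert a X) b))\<^sup>2) = p a * q b - q a * p b"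
  proof (cases "p a = 0")
    case True
    then have "p = 0" using pa H nrm_eq_0 by auto
    then show ?thesis by simp
  qed (simp add: field_simps)
  also have "q a * p b = complex_of_real ((cmod (p b))\<^sup>2)"
    unfolding qp by (simp only: complex_norm_square mult.commute)
  finally show ?thesis
    unfolding pa qb pq[symmetric] of_real_mult[symmetric] of_real_diff[symmetric] of_real_eq_iff .
qed

text \<open>Both sides are the square root of the same Gram determinant, whose off-diagonal entries
  are conjugate. This makes the volume below independent of the order of the nodes.\<close>

lemma nrm_residual_swap:
  assumes "finite X" "X \<subseteq> D" "a \<in> D" "b \<in> D"
  shows "nrm (residual X a) * nrm (residual (insert a X) b) =
    nrm (residual X b) * nrm (residual (insert b X) a)"
proof -
  have H: "residual X a \<in> H" "residual X b \<in> H"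
    "residual (insert a X) b \<in> H" "residual (insert b X) a \<in> H"
    using assms by (auto intro!: residual_mem)
  have "ip (residual X a) (residual X b) = residual X a b"
    by (rule residual_ip[OF assms(1,2,4) H(1) residual_vanish[OF assms(1-3)]])
  moreover have "ip (residual X b) (residual X a) = residual X b a"
    by (rule residual_ip[OF assms(1,2,3) H(2) residual_vanish[OF assms(1,2,4)]])
  ultimately have "residual X a b = cnj (residual X b a)"
    using ip_cnj[OF H(1,2)] by metis
  then have "(nrm (residual X a) * nrm (residual (insert a X) b))\<^sup>2 =
    (nrm (residual X b) * nrm (residual (insert b X) a))\<^sup>2"
    using nrm_residual_insert[OF assms] nrm_residual_insert[OF assms(1,2,4,3)]
    by (simp add: power_mult_distrib)
  then show ?thesis
    by (rule power2_eq_imp_eq) (intro mult_nonneg_nonneg nrm_nonneg H)+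
qed

section \<open>Interpolation by kernel sections\<close>

text \<open>The residual of \<open>y\<close> over the other nodes vanishes at them, so dividing by
  its value at \<open>y\<close> gives the cardinal function. By the reproducing property these
  functions are dual to the sections.\<close>

definition lagrange :: "'a set \<Rightarrow> 'a \<Rightarrow> 'a \<Rightarrow> complex" where
  "lagrange X y = fscale (1 / residual (X - {y}) y y) (residual (X - {y}) y)"

text \<open>Hypothesis \<open>unisolvent\<close> says that no section at a node lies in the span of
  the others, so the sections at \<open>X\<close> form a basis of their span.\<close>

context
  fixes X
  assumes X: "finite X" "X \<subseteq> D"
    and unisolvent: "\<And>y. y \<in> X \<Longrightarrow> 0 < nrm (residual (X - {y}) y)"
begin

lemma residual_delete:
  assumes "y \<in> X"
  shows "residual (X - {y}) y \<in> H"
    and "residual (X - {y}) y y = complex_of_real ((nrm (residual (X - {y}) y))\<^sup>2)"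
    and "\<And>z. z \<in> X - {y} \<Longrightarrow> residual (X - {y}) y z = 0"
    and "residual (X - {y}) y \<in> cfun.span (ksec ` X)"
proof -
  have Xy: "finite (X - {y})" "X - {y} \<subseteq> D" "y \<in> D" using X assms by auto
  show "residual (X - {y}) y \<in> H" by (rule residual_mem[OF Xy])
  show "residual (X - {y}) y y = complex_of_real ((nrm (residual (X - {y}) y))\<^sup>2)"
    by (rule residual_self[OF Xy])
  show "residual (X - {y}) y z = 0" if "z \<in> X - {y}" for z
    by (rule residual_vanish[OF Xy that])
  have "cfun.span (ksec ` (X - {y})) \<subseteq> cfun.span (ksec ` X)"
    by (intro cfun.span_mono) auto
  then have "ksec y - residual (X - {y}) y \<in> cfun.span (ksec ` X)"
    using residual_span[OF Xy] by blast
  moreover have "ksec y \<in> cfun.span (ksec ` X)"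
    using assms by (intro cfun.span_base) simp
  ultimately have "ksec y - (ksec y - residual (X - {y}) y) \<in> cfun.span (ksec ` X)"
    by (rule cfun.span_diff[rotated])
  moreover have "ksec y - (ksec y - residual (X - {y}) y) = residual (X - {y}) y" by simp
  ultimately show "residual (X - {y}) y \<in> cfun.span (ksec ` X)" by metis
qed

lemma lagrange_mem: "y \<in> X \<Longrightarrow> lagrange X y \<in> H"
  by (simp add: lagrange_def mem_simps residual_delete(1))

lemma lagrange_span: "y \<in> X \<Longrightarrow> lagrange X y \<in> cfun.span (ksec ` X)"
  unfolding lagrange_def by (intro cfun.span_scale residual_delete(4))

lemma lagrange_apply:
  assumes "y \<in> X" "z \<in> X"
  shows "lagrange X y z = (if z = y then 1 else 0)"
proof (cases "z = y")
  case True
  then show ?thesis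
    using residual_delete(2)[OF assms(1)] unisolvent[OF assms(1)] by (simp add: lagrange_def)
next
  case False
  then show ?thesis
    using residual_delete(3)[OF assms(1), of z] assms by (simp add: lagrange_def)
qed

lemma nrm_lagrange:
  assumes "y \<in> X"
  shows "nrm (lagrange X y) = 1 / nrm (residual (X - {y}) y)"
  using unisolvent[OF assms]
  by (simp add: lagrange_def nrm_scale residual_delete(1)[OF assms] residual_delete(2)[OF assms]
      norm_divide norm_power del: of_real_power) (simp add: power2_eq_square)

abbreviation interpolant :: "('a \<Rightarrow> complex) \<Rightarrow> 'a \<Rightarrow> complex" where
  "interpolant f \<equiv> \<Sum>y\<in>X. fscale (f y) (lagrange X y)"

lemma interpolant_apply:
  assumes "z \<in> X"
  shows "interpolant f z = f z"
proof -
  have "interpolant f z = (\<Sum>y\<in>X. if y = z then f y else 0)"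
    unfolding sum_fun_apply fscale_apply
    by (intro sum.cong refl) (use assms in \<open>auto simp: lagrange_apply\<close>)
  then show ?thesis using assms X by simp
qed

lemma interpolant_mem: "interpolant f \<in> H"
  by (intro mem_simps lagrange_mem)

lemma interpolant_span: "interpolant f \<in> cfun.span (ksec ` X)"
  by (intro cfun.span_sum cfun.span_scale lagrange_span)

lemma interpolant_eq:
  assumes "f \<in> cfun.span (ksec ` X)"
  shows "interpolant f = f"
proof -
  have "interpolant f - f = 0"
    by (intro vanishing_in_span_eq_0[OF X(2)] cfun.span_diff interpolant_span assms)
      (simp add: interpolant_apply)
  then show ?thesis by simp
qed

text \<open>The error vanishes on \<open>X\<close>, so the residual evaluates it at
  \<open>x\<close>; the interpolant itself lies in the span and is orthogonal to the
  residual.\<close>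

lemma interpolation_error:
  assumes f: "f \<in> H" and x: "x \<in> D"
  shows "f x - interpolant f x = ip f (residual X x)"
proof -
  let ?r = "residual X x"
  have r: "?r \<in> H" by (rule residual_mem[OF X x])
  have "ip ?r (interpolant f) = 0"
    by (rule vanishing_orthogonal_span[OF X(2) r residual_vanish[OF X x] interpolant_span])
  then have "ip (interpolant f) ?r = 0"
    using ip_cnj[OF interpolant_mem r] by simp
  moreover have "ip (f - interpolant f) ?r = (f - interpolant f) x"
    by (intro residual_ip X x mem_simps f interpolant_mem) (simp add: interpolant_apply)
  ultimately show ?thesis
    using ip_diff[OF f interpolant_mem r] by simp
qed

lemma interpolation_error_le:
  assumes "f \<in> H" "x \<in> D"
  shows "cmod (f x - interpolant f x) \<le> nrm f * nrm (residual X x)"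
  unfolding interpolation_error[OF assms]
  by (rule cauchy_schwarz[OF assms(1) residual_mem[OF X assms(2)]])

text \<open>On a space of dimension \<open>card X\<close> the kernel of \<open>A\<close> has
  dimension at least \<open>card X - card B\<close>. Each new vector solves \<open>card B\<close>
  equations for the kernel and \<open>t\<close> for orthogonality, in \<open>card X\<close>
  unknowns.\<close>

lemma orthonormal_system_in_kernel:
  assumes A: "clinear_map H F A"
    and B: "finite B" "cfun.independent B" "A ` H \<subseteq> cfun.span B"
    and "t + card B \<le> card X"
  shows "\<exists>u. (\<forall>i<t. u i \<in> cfun.span (ksec ` X) \<and> A (u i) = 0) \<and>
    (\<forall>i<t. \<forall>j<t. ip (u i) (u j) = (if i = j then 1 else 0))"
  using assms(5)
proof (induction t)
  case 0
  then show ?case by auto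
next
  case (Suc t)
  then obtain u where u: "\<And>i. i < t \<Longrightarrow> u i \<in> cfun.span (ksec ` X)" "\<And>i. i < t \<Longrightarrow> A (u i) = 0"
    and orth: "\<And>i j. \<lbrakk>i < t; j < t\<rbrakk> \<Longrightarrow> ip (u i) (u j) = (if i = j then 1 else 0)"
    using Suc_leD by (metis add_Suc)
  have uH: "u i \<in> H" if "i < t" for i
    using u(1)[OF that] span_sections_subset[OF X(2)] by auto
  \<comment> \<open>The left summand indexes the coordinates of the image under \<open>A\<close> in
    the basis \<open>B\<close>, the right one the inner products with the vectors already
    found.\<close>
  define a where "a = (\<lambda>y. case_sum (cfun.representation B (A (lagrange X y))) (\<lambda>j. ip (lagrange X y) (u j)))"
  have "finite (B <+> {..<t})" "card (B <+> {..<t}) < card X"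
    using B(1) Suc.prems by (auto simp: card_Plus)
  from homogeneous_system_nontrivial_solution[OF this(1) X(1) this(2), of a]
  obtain c where c: "\<exists>y\<in>X. c y \<noteq> 0" "\<And>j. j \<in> B <+> {..<t} \<Longrightarrow> (\<Sum>y\<in>X. c y * a y j) = 0"
    by auto
  define v where "v = interpolant c"
  have v: "v \<in> H" "v \<in> cfun.span (ksec ` X)"
    unfolding v_def by (rule interpolant_mem interpolant_span)+
  \<comment> \<open>The values of \<open>v\<close> at the nodes are the coefficients
    \<open>c\<close>.\<close>
  have "v \<noteq> 0" using c(1) interpolant_apply[of _ c] by (auto simp: v_def)
  then have nv: "nrm v > 0" using nrm_nonneg[OF v(1)] nrm_eq_0[OF v(1)] by fastforce
  have "A v = (\<Sum>y\<in>X. fscale (c y) (A (lagrange X y)))"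
    unfolding v_def by (intro clinear_map_sum[OF A subspace X(1)] lagrange_mem)
  also have "\<dots> = (\<Sum>y\<in>X. fscale (c y) (\<Sum>b\<in>B. fscale (a y (Inl b)) b))"
  proof (intro sum.cong refl arg_cong2[of _ _ _ _ fscale])
    fix y assume "y \<in> X"
    then have "A (lagrange X y) \<in> cfun.span B" using B(3) lagrange_mem by blast
    then show "A (lagrange X y) = (\<Sum>b\<in>B. fscale (a y (Inl b)) b)"
      unfolding a_def sum.case by (intro cfun.sum_representation_eq[symmetric] B(1,2) order_refl)
  qed
  also have "\<dots> = (\<Sum>b\<in>B. fscale (\<Sum>y\<in>X. c y * a y (Inl b)) b)"
    by (simp only: cfun.scale_sum_right cfun.scale_sum_left cfun.scale_scale sum.swap[of _ B X])
  also have "\<dots> = (\<Sum>b\<in>B. 0)"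
    by (intro sum.cong refl) (simp add: c(2) InlI)
  finally have Av: "A v = 0" by simp
  have vu: "ip v (u j) = 0" if "j < t" for j
  proof -
    have "ip v (u j) = (\<Sum>y\<in>X. c y * ip (lagrange X y) (u j))"
      unfolding v_def using that by (intro ip_sum X lagrange_mem uH)
    also have "\<dots> = (\<Sum>y\<in>X. c y * a y (Inr j))" by (simp add: a_def)
    finally show ?thesis using c(2)[of "Inr j"] that by (simp add: InrI)
  qed
  have uv: "ip (u j) v = 0" if "j < t" for j
    using vu[OF that] ip_cnj[OF uH[OF that] v(1)] by simp
  define w where "w = fscale (complex_of_real (1 / nrm v)) v"
  have w: "w \<in> H" "w \<in> cfun.span (ksec ` X)"
    unfolding w_def using v by (auto intro: mem_simps cfun.span_scale)
  have "nrm w = 1"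
    unfolding w_def using nv by (simp add: nrm_scale[OF v(1)] norm_divide)
  then have ww: "ip w w = 1" using ip_self[OF w(1)] by simp
  have wu: "ip w (u j) = 0" "ip (u j) w = 0" if "j < t" for j
    unfolding w_def using vu uv that v(1) uH by (auto simp: ip_scale ip_scale_right)
  have "A w = fscale (complex_of_real (1 / nrm v)) (A v)"
    unfolding w_def using A v(1) unfolding clinear_map_def by blast
  then have "A w = 0" unfolding Av by simp
  then have "\<forall>i<Suc t. (u(t := w)) i \<in> cfun.span (ksec ` X) \<and> A ((u(t := w)) i) = 0"
    using u w by (simp add: less_Suc_eq)
  moreover have "\<forall>i<Suc t. \<forall>j<Suc t. ip ((u(t := w)) i) ((u(t := w)) j) = (if i = j then 1 else 0)"
    using orth ww wu by (simp add: less_Suc_eq)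
  ultimately show ?case by blast
qed

text \<open>
  The trace of the orthogonal projection onto \<open>ker A \<inter> span {K\<^sub>y | y \<in> X}\<close> is computed in the
  basis \<open>K\<^sub>y\<close> and its dual basis, the Lagrange functions.  A function in \<open>ker A\<close> is its own error.
\<close>
lemma residual_le_approximation_error:
  assumes A: "clinear_map H F A" "finite_dim (A ` H)"
    and err: "\<And>f x. \<lbrakk>f \<in> H; nrm f \<le> 1; x \<in> D\<rbrakk> \<Longrightarrow> cmod (f x - A f x) \<le> e"
    and e: "0 \<le> e" and \<delta>: "0 < \<delta>" "\<And>y. y \<in> X \<Longrightarrow> \<delta> \<le> nrm (residual (X - {y}) y)"
  shows "(real (card X) - real (cfun.dim (A ` H))) * \<delta> \<le> real (card X) * e"
proof (cases "cfun.dim (A ` H) \<le> card X")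
  case False
  then have "(real (card X) - real (cfun.dim (A ` H))) * \<delta> \<le> 0"
    using \<delta>(1) by (intro mult_nonpos_nonneg) auto
  also have "\<dots> \<le> real (card X) * e" using e by simp
  finally show ?thesis .
next
  case True
  obtain B where B: "B \<subseteq> A ` H" "cfun.independent B" "A ` H \<subseteq> cfun.span B" "card B = cfun.dim (A ` H)"
    using cfun.basis_exists by blast
  \<comment> \<open>\<open>cfun.dim\<close> is 0 in infinite dimension too, so finiteness of
    \<open>B\<close> is drawn from \<open>finite_dim\<close>.\<close>
  obtain B' where "finite B'" "A ` H \<subseteq> cfun.span B'" using A(2) unfolding finite_dim_def by blast
  then have "finite B" using cfun.independent_span_bound[of B' B] B by auto
  define t where "t = card X - card B"
  have "t + card B \<le> card X" using True B(4) by (simp add: t_def)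
  from orthonormal_system_in_kernel[OF A(1) \<open>finite B\<close> B(2,3) this]
  obtain u where u: "\<And>i. i < t \<Longrightarrow> u i \<in> cfun.span (ksec ` X)" "\<And>i. i < t \<Longrightarrow> A (u i) = 0"
    and orth: "\<And>i j. \<lbrakk>i < t; j < t\<rbrakk> \<Longrightarrow> ip (u i) (u j) = (if i = j then 1 else 0)"
    by auto
  have uH: "u i \<in> H" if "i < t" for i
    using u(1)[OF that] span_sections_subset[OF X(2)] by auto
  \<comment> \<open>The projection of \<open>ksec y\<close> onto the span of the \<open>u j\<close>,
    since \<open>ip (ksec y) (u j)\<close> is the conjugate of \<open>u j y\<close>.\<close>
  define w where "w y = (\<Sum>j<t. fscale (cnj (u j y)) (u j))" for y
  have wH: "w y \<in> H" for y
    unfolding w_def by (intro mem_simps uH) simp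
  have Aw: "A (w y) = 0" for y
    unfolding w_def using clinear_map_sum[OF A(1) subspace finite_lessThan, of t u] uH u(2) by simp
  have ip_uw: "ip (u j) (w y) = u j y" if "j < t" for j y
  proof -
    have "ip (u j) (w y) = (\<Sum>i<t. cnj (cnj (u i y)) * ip (u j) (u i))"
      unfolding w_def using that by (intro ip_sum_right uH) auto
    also have "\<dots> = (\<Sum>i<t. if i = j then u i y else 0)"
      using that orth by (intro sum.cong refl) auto
    finally show ?thesis using that by simp
  qed
  \<comment> \<open>After normalization \<open>w y\<close> is in the unit ball and in the kernel of
    \<open>A\<close>, and its value at \<open>y\<close> is \<open>nrm (w y)\<close> because
    \<open>w y y = ip (w y) (w y)\<close>.\<close>
  have w_le: "nrm (w y) \<le> e" if "y \<in> X" for y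
  proof (cases "nrm (w y) = 0")
    case True
    then show ?thesis using e by simp
  next
    case False
    then have pos: "0 < nrm (w y)" using nrm_nonneg[OF wH] by (simp add: less_le)
    define g where "g = fscale (complex_of_real (1 / nrm (w y))) (w y)"
    have g: "g \<in> H" "nrm g \<le> 1"
      unfolding g_def using pos by (simp_all add: mem_simps wH nrm_scale norm_divide)
    have "A g = fscale (complex_of_real (1 / nrm (w y))) (A (w y))"
      unfolding g_def using A(1) wH unfolding clinear_map_def by blast
    then have "A g = 0" unfolding Aw by simp
    then have "cmod (g y) \<le> e" using err[OF g, of y] that X(2) by auto
    moreover have "ip (w y) (w y) = (\<Sum>j<t. cnj (u j y) * ip (u j) (w y))"
      by (subst (1) w_def) (intro ip_sum uH wH; simp)
    then have "ip (w y) (w y) = w y y"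
      by (simp add: ip_uw) (simp add: w_def sum_fun_apply)
    then have "w y y = complex_of_real ((nrm (w y))\<^sup>2)"
      using ip_self[OF wH] by simp
    then have "g y = complex_of_real (nrm (w y))"
      using pos by (simp add: g_def power2_eq_square)
    ultimately show ?thesis using pos by simp
  qed
  \<comment> \<open>The trace over the orthonormal basis is regrouped by nodes: the first
    \<open>u j\<close> is expanded by its node values, which then collect into
    \<open>w y\<close>.\<close>
  have "complex_of_nat t = (\<Sum>j<t. ip (u j) (u j))"
    using orth by simp
  also have "\<dots> = (\<Sum>j<t. ip (interpolant (u j)) (u j))"
    using u(1) by (simp add: interpolant_eq)
  also have "\<dots> = (\<Sum>j<t. \<Sum>y\<in>X. u j y * ip (lagrange X y) (u j))"
    by (intro sum.cong refl ip_sum X lagrange_mem uH) auto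
  also have "\<dots> = (\<Sum>y\<in>X. \<Sum>j<t. cnj (cnj (u j y)) * ip (lagrange X y) (u j))"
    by (subst sum.swap) simp
  also have "\<dots> = (\<Sum>y\<in>X. ip (lagrange X y) (w y))"
    unfolding w_def by (intro sum.cong refl ip_sum_right[symmetric] lagrange_mem uH) auto
  finally have "real t = cmod (\<Sum>y\<in>X. ip (lagrange X y) (w y))"
    by (metis norm_of_nat)
  also have "\<dots> \<le> (\<Sum>y\<in>X. 1 / \<delta> * e)"
  proof (rule sum_norm_le)
    fix y assume y: "y \<in> X"
    have "cmod (ip (lagrange X y) (w y)) \<le> nrm (lagrange X y) * nrm (w y)"
      by (rule cauchy_schwarz[OF lagrange_mem[OF y] wH])
    also have "\<dots> \<le> 1 / \<delta> * e"
      using nrm_lagrange[OF y] \<delta>(1) \<delta>(2)[OF y] w_le[OF y] e nrm_nonneg[OF wH]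
      by (intro mult_mono) (auto intro: divide_left_mono)
    finally show "cmod (ip (lagrange X y) (w y)) \<le> 1 / \<delta> * e" .
  qed
  finally have "real t * \<delta> \<le> real (card X) * e"
    using \<delta>(1) by (simp add: field_simps)
  then show ?thesis using True B(4) by (simp add: t_def of_nat_diff)
qed

end

section \<open>Nodes of almost maximal volume\<close>

text \<open>By Gram-Schmidt, this is the volume of the parallelepiped spanned by the \<open>K\<^sub>x\<close>.\<close>
primrec volume :: "'a list \<Rightarrow> real" where
  "volume [] = 1"
| "volume (x # xs) = nrm (residual (set xs) x) * volume xs"

lemma volume_nonneg: "set xs \<subseteq> D \<Longrightarrow> 0 \<le> volume xs"
  by (induction xs) (auto intro!: mult_nonneg_nonneg nrm_nonneg residual_mem)

lemma volume_le:
  assumes "\<And>x. x \<in> D \<Longrightarrow> sqrt (Re (K x x)) \<le> b" "set xs \<subseteq> D"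
  shows "volume xs \<le> b ^ length xs"
  using assms(2)
proof (induction xs)
  case (Cons x xs)
  then have "nrm (residual (set xs) x) \<le> b" "0 \<le> nrm (residual (set xs) x)"
    using nrm_residual_le[of "set xs" x] assms(1)[of x] by (auto intro!: nrm_nonneg residual_mem)
  then show ?case using Cons volume_nonneg by (auto intro!: mult_mono)
qed simp

text \<open>The entry \<open>x\<close> moves to the front by successive transpositions, each of
  which preserves the volume by \<open>nrm_residual_swap\<close>.\<close>

lemma volume_remove1:
  assumes "x \<in> set xs" "set xs \<subseteq> D"
  shows "volume xs = volume (x # remove1 x xs)"
  using assms
proof (induction xs)
  case (Cons y ys)
  show ?case
  proof (cases "x = y")
    case False
    define zs where "zs = remove1 x ys"
    have x: "x \<in> set ys" "x \<in> D" "y \<in> D" using Cons.prems False by auto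
    have zD: "set zs \<subseteq> D" using Cons.prems set_remove1_subset[of x ys] by (auto simp: zs_def)
    have "set ys = insert x (set zs)"
      using x(1) set_remove1_subset[of x ys] in_set_remove1[of _ x ys] unfolding zs_def by blast
    moreover have "volume ys = nrm (residual (set zs) x) * volume zs"
      using Cons x by (simp add: zs_def)
    ultimately show ?thesis
      using False nrm_residual_swap[OF finite_set zD x(2,3)] by (simp add: zs_def mult_ac)
  qed simp
qed simp

text \<open>The residual of a repeated node vanishes at that node, hence has norm 0 and annihilates
  the product.\<close>

lemma volume_pos_distinct:
  assumes "0 < volume xs" "set xs \<subseteq> D"
  shows "distinct xs"
  using assms
proof (induction xs)
  case (Cons x xs)
  have "0 \<le> nrm (residual (set xs) x)" using Cons.prems by (auto intro!: nrm_nonneg residual_mem)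
  then have pos: "0 < nrm (residual (set xs) x)" "0 < volume xs"
    using Cons.prems by (auto simp: zero_less_mult_iff)
  have "x \<notin> set xs"
  proof
    assume "x \<in> set xs"
    then have "residual (set xs) x x = 0" using Cons.prems by (intro residual_vanish) auto
    then show False using residual_self[of "set xs" x] pos Cons.prems by simp
  qed
  then show ?case using Cons pos by simp
qed simp

lemma volume_pos_unisolvent:
  assumes "0 < volume xs" "set xs \<subseteq> D" "y \<in> set xs"
  shows "0 < nrm (residual (set xs - {y}) y)"
proof -
  have eq: "set (remove1 y xs) = set xs - {y}"
    using volume_pos_distinct[OF assms(1,2)] by (simp add: set_remove1_eq)
  then have "0 \<le> volume (remove1 y xs)" using assms by (intro volume_nonneg) auto
  moreover have "0 < nrm (residual (set xs - {y}) y) * volume (remove1 y xs)"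
    using volume_remove1[OF assms(3,2)] assms(1) eq by simp
  ultimately show ?thesis by (auto simp: zero_less_mult_iff)
qed

text \<open>Zero residuals make every function in \<open>H\<close> equal to its interpolant, which
  lies in the span of finitely many sections.\<close>

lemma finite_dim_if_residuals_vanish:
  assumes "0 < volume xs" "set xs \<subseteq> D" "\<And>x. x \<in> D \<Longrightarrow> nrm (residual (set xs) x) = 0"
  shows "finite_dim H"
proof -
  have "f \<in> cfun.span (ksec ` set xs)" if f: "f \<in> H" for f
  proof -
    note uni = finite_set assms(2) volume_pos_unisolvent[OF assms(1,2)]
    let ?g = "interpolant (set xs) f"
    have "?g \<in> H" by (rule interpolant_mem[OF uni])
    have "f x = ?g x" for x
    proof (cases "x \<in> D")
      case True
      then show ?thesis using interpolation_error_le[OF uni f True] assms(3) by simp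
    next
      case False
      have "h x = 0" if "h \<in> H" for h
        using that vanish_off False by (auto simp: funs_on_def)
      from this[OF f] this[OF \<open>?g \<in> H\<close>] show ?thesis by simp
    qed
    then have "f = ?g" by (rule ext)
    then show ?thesis using interpolant_span[OF uni, of f] by metis
  qed
  then show ?thesis unfolding finite_dim_def by blast
qed

text \<open>Infinite dimension always leaves a point with nonzero residual, which can be prepended
  to the list.\<close>

lemma exists_volume_pos:
  assumes "\<not> finite_dim H"
  shows "\<exists>xs. length xs = m \<and> set xs \<subseteq> D \<and> 0 < volume xs"
proof (induction m)
  case (Suc m)
  then obtain xs where xs: "length xs = m" "set xs \<subseteq> D" "0 < volume xs" by auto
  then obtain x where x: "x \<in> D" "nrm (residual (set xs) x) \<noteq> 0"
    using finite_dim_if_residuals_vanish assms by blast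
  have "0 \<le> nrm (residual (set xs) x)" using x xs by (intro nrm_nonneg residual_mem) auto
  then show ?case using x xs by (intro exI[of _ "x # xs"]) auto
qed simp

text \<open>The factor 2 makes a maximizer unnecessary, so that the kernel only has to be bounded.\<close>
lemma exists_almost_maximal_volume:
  assumes "\<not> finite_dim H" and bdd: "\<And>x. x \<in> D \<Longrightarrow> sqrt (Re (K x x)) \<le> b"
  shows "\<exists>xs. length xs = m \<and> set xs \<subseteq> D \<and> 0 < volume xs \<and>
    (\<forall>ys. length ys = m \<longrightarrow> set ys \<subseteq> D \<longrightarrow> volume ys \<le> 2 * volume xs)"
proof -
  define V where "V = volume ` {ys. length ys = m \<and> set ys \<subseteq> D}"
  obtain zs where zs: "length zs = m" "set zs \<subseteq> D" "0 < volume zs"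
    using exists_volume_pos[OF assms(1)] by blast
  have "volume ys \<le> b ^ m" if "length ys = m" "set ys \<subseteq> D" for ys
    using volume_le[OF bdd that(2)] that(1) by simp
  then have V: "volume zs \<in> V" "bdd_above V"
    using zs by (auto simp: V_def intro!: bdd_aboveI[of _ "b ^ m"])
  have pos: "0 < Sup V" using cSup_upper[OF V] zs by linarith
  then have "Sup V / 2 < Sup V" by simp
  then obtain xs where xs: "length xs = m" "set xs \<subseteq> D" "Sup V / 2 < volume xs"
    using less_cSup_iff[of V "Sup V / 2"] V by (auto simp: V_def)
  have "volume ys \<le> 2 * volume xs" if "length ys = m" "set ys \<subseteq> D" for ys
    using cSup_upper[OF _ V(2), of "volume ys"] that xs by (auto simp: V_def)
  then show ?thesis using xs pos by (intro exI[of _ xs]) auto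
qed

text \<open>Exchanging \<open>x\<close> for a node at most doubles the volume, which is a multiple of that node's residual.\<close>
lemma residual_exchange:
  assumes xs: "set xs \<subseteq> D" "0 < volume xs"
    and max: "\<And>ys. \<lbrakk>length ys = length xs; set ys \<subseteq> D\<rbrakk> \<Longrightarrow> volume ys \<le> 2 * volume xs"
    and x: "x \<in> D" and pos: "0 < nrm (residual (set xs) x)"
    and y: "y \<in> insert x (set xs)"
  shows "nrm (residual (set xs) x) / 2 \<le> nrm (residual (insert x (set xs) - {y}) y)"
proof -
  have "x \<notin> set xs"
    using volume_pos_distinct[of "x # xs"] xs x pos by simp
  show ?thesis
  proof (cases "y = x")
    case True
    then show ?thesis using \<open>x \<notin> set xs\<close> pos by simp
  next
    case False
    then have y: "y \<in> set xs" using y by simp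
    define Z where "Z = set xs - {y}"
    define zs where "zs = remove1 y xs"
    have zs: "set zs = Z"
      using volume_pos_distinct[OF xs(2,1)] by (simp add: set_remove1_eq zs_def Z_def)
    have Z: "finite Z" "Z \<subseteq> D" and "y \<in> D" using xs y by (auto simp: Z_def)
    have ins: "insert y Z = set xs" "insert x (set xs) - {y} = insert x Z"
      using y False by (auto simp: Z_def)
    have vol: "volume xs = nrm (residual Z y) * volume zs"
      using volume_remove1[OF y xs(1)] zs by (simp add: zs_def)
    have "0 \<le> nrm (residual Z y)" by (intro nrm_nonneg residual_mem Z \<open>y \<in> D\<close>)
    then have p: "0 < nrm (residual Z y)" "0 < volume zs"
      using xs(2) vol by (auto simp: zero_less_mult_iff)
    have "volume (x # zs) \<le> 2 * volume xs"
    proof (rule max)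
      show "length (x # zs) = length xs"
        using y length_pos_if_in_set[OF y] by (simp add: zs_def length_remove1)
      show "set (x # zs) \<subseteq> D" using x zs Z by simp
    qed
    then have "nrm (residual Z x) \<le> 2 * nrm (residual Z y)"
      using vol zs p(2) by simp
    \<comment> \<open>Over \<open>Z\<close> the points \<open>x\<close> and \<open>y\<close> span
      the same area in either order; bounding \<open>nrm (residual Z x)\<close> lets the factor
      \<open>nrm (residual Z y)\<close> cancel.\<close>
    have "nrm (residual Z y) * nrm (residual (set xs) x) =
        nrm (residual Z x) * nrm (residual (insert x Z) y)"
      using nrm_residual_swap[OF Z \<open>y \<in> D\<close> x] ins by simp
    also have "\<dots> \<le> 2 * nrm (residual Z y) * nrm (residual (insert x Z) y)"
      using \<open>nrm (residual Z x) \<le> 2 * nrm (residual Z y)\<close> Z x \<open>y \<in> D\<close>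
      by (intro mult_right_mono nrm_nonneg residual_mem) auto
    finally have "nrm (residual (set xs) x) \<le> 2 * nrm (residual (insert x Z) y)"
      using p(1) by simp
    then show ?thesis using ins by simp
  qed
qed

text \<open>The trace bound is applied to the nodes together with \<open>x\<close>, with half the
  residual at \<open>x\<close> as lower bound \<open>\<delta>\<close>; this half is the factor 2 on
  the right.\<close>

lemma almost_maximal_volume_residual_le:
  assumes xs: "set xs \<subseteq> D" "0 < volume xs"
    and max: "\<And>ys. \<lbrakk>length ys = length xs; set ys \<subseteq> D\<rbrakk> \<Longrightarrow> volume ys \<le> 2 * volume xs"
    and A: "clinear_map H F A" "finite_dim (A ` H)"
    and err: "\<And>f x. \<lbrakk>f \<in> H; nrm f \<le> 1; x \<in> D\<rbrakk> \<Longrightarrow> cmod (f x - A f x) \<le> e"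
    and e: "0 \<le> e" and x: "x \<in> D"
  shows "(real (length xs) + 1 - real (cfun.dim (A ` H))) * nrm (residual (set xs) x)
    \<le> 2 * (real (length xs) + 1) * e"
proof (cases "nrm (residual (set xs) x) = 0")
  case True
  then show ?thesis using e by simp
next
  case False
  define s where "s = nrm (residual (set xs) x)"
  have "0 \<le> s" unfolding s_def by (intro nrm_nonneg residual_mem xs(1) x finite_set)
  then have s: "0 < s" using False by (simp add: s_def)
  define Y where "Y = insert x (set xs)"
  have Y: "finite Y" "Y \<subseteq> D" using xs x by (auto simp: Y_def)
  have "distinct (x # xs)"
    using volume_pos_distinct[of "x # xs"] xs x s by (simp add: s_def)
  then have card: "card Y = length xs + 1"
    using distinct_card[of "x # xs"] by (simp add: Y_def)
  have half: "s / 2 \<le> nrm (residual (Y - {y}) y)" if "y \<in> Y" for y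
    using residual_exchange[OF xs max x s[unfolded s_def] that[unfolded Y_def]]
    unfolding s_def Y_def .
  have pos: "0 < nrm (residual (Y - {y}) y)" if "y \<in> Y" for y
    using half[OF that] s by linarith
  have "0 < s / 2" using s by simp
  from residual_le_approximation_error[OF Y pos A err e this half]
  have "(real (card Y) - real (cfun.dim (A ` H))) * (s / 2) \<le> real (card Y) * e" .
  then show ?thesis unfolding card s_def[symmetric] by (simp add: field_simps)
qed

section \<open>Sampling numbers\<close>

lemma cmod_le_nrm:
  assumes "f \<in> H" "x \<in> D"
  shows "cmod (f x) \<le> nrm f * sqrt (Re (K x x))"
proof -
  have e: "finite {}" "{} \<subseteq> D" by auto
  have "cmod (f x) \<le> nrm f * nrm (residual {} x)"
    using residual_ip[OF e assms(2,1)] cauchy_schwarz[OF assms(1) residual_mem[OF e assms(2)]] by simp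
  also have "\<dots> \<le> nrm f * sqrt (Re (K x x))"
    by (intro mult_left_mono nrm_residual_le e assms nrm_nonneg)
  finally show ?thesis .
qed

lemma subset_linf:
  assumes "bdd_above ((\<lambda>x. sqrt (Re (K x x))) ` D)"
  shows "H \<subseteq> linf D"
proof
  fix f assume f: "f \<in> H"
  obtain b where b: "\<And>x. x \<in> D \<Longrightarrow> sqrt (Re (K x x)) \<le> b"
    using assms by (auto simp: bdd_above_def)
  have "cmod (f x) \<le> nrm f * b" if "x \<in> D" for x
    using cmod_le_nrm[OF f that] mult_left_mono[OF b[OF that] nrm_nonneg[OF f]] by linarith
  then have "bounded (f ` D)" by (auto simp: bounded_iff)
  then show "f \<in> linf D" using f vanish_off by (auto simp: linf_def)
qed

lemma cmod_le_linf_norm: "\<lbrakk>f \<in> linf D; x \<in> D\<rbrakk> \<Longrightarrow> cmod (f x) \<le> linf_norm D f"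
  unfolding linf_norm_def
  by (rule cSUP_upper) (auto simp: linf_def bounded_iff intro: bdd_aboveI)

lemma diff_in_linf:
  assumes "f \<in> linf D" "g \<in> linf D"
  shows "f - g \<in> linf D"
proof -
  obtain a b where "\<And>x. x \<in> D \<Longrightarrow> cmod (f x) \<le> a" "\<And>x. x \<in> D \<Longrightarrow> cmod (g x) \<le> b"
    using assms by (auto simp: linf_def bounded_iff)
  then have "cmod ((f - g) x) \<le> a + b" if "x \<in> D" for x
    using norm_triangle_ineq4[of "f x" "g x"] that by fastforce
  then show ?thesis
    using assms unfolding linf_def funs_on_def bounded_iff by (auto simp del: minus_apply) auto
qed

text \<open>Interpolation at nodes of almost maximal volume is the sampling operator. The nodes are
  fixed before \<open>A\<close>, so one choice competes with all operators of rank below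
  \<open>n\<close>.\<close>

lemma sampling_number_le_approx_number:
  assumes inf_dim: "\<not> finite_dim H"
    and bdd: "bdd_above ((\<lambda>x. sqrt (Re (K x x))) ` D)"
    and n: "2 * n \<le> m"
  shows "sampling_number D H nrm (linf D) (linf_norm D) m
    \<le> ennreal 4 * approx_number H nrm (linf D) (linf_norm D) n"
proof -
  obtain b where b: "\<And>x. x \<in> D \<Longrightarrow> sqrt (Re (K x x)) \<le> b"
    using bdd by (auto simp: bdd_above_def)
  obtain zs where "length zs = 1" "set zs \<subseteq> D"
    using exists_volume_pos[OF inf_dim, of 1] by auto
  \<comment> \<open>Bounding the supremum in \<open>linf_norm\<close> from above requires a nonempty
    \<open>D\<close>.\<close>
  then have "D \<noteq> {}" by (cases zs) auto
  from exists_almost_maximal_volume[OF inf_dim b, of m]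
  obtain xs where xs: "length xs = m" "set xs \<subseteq> D" "0 < volume xs"
    and max: "\<And>ys. \<lbrakk>length ys = m; set ys \<subseteq> D\<rbrakk> \<Longrightarrow> volume ys \<le> 2 * volume xs"
    by blast
  note uni = finite_set xs(2) volume_pos_unisolvent[OF xs(3,2)]
  define R where "R y = (\<Sum>i<m. fscale (y i) (lagrange (set xs) (xs ! i)))" for y :: "nat \<Rightarrow> complex"
  have nodes: "xs ! i \<in> set xs" if "i < m" for i using that xs(1) by simp
  have "R y \<in> H" for y
    unfolding R_def by (intro mem_simps lagrange_mem[OF uni] nodes) auto
  then have "R y \<in> linf D" for y using subset_linf[OF bdd] by blast
  then have R: "clinear_map (funs_on {..<m}) (linf D) R"
  proof (unfold clinear_map_def, intro conjI ballI allI)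
    show "R (y + z) = R y + R z" for y z
      by (simp add: R_def cfun.scale_left_distrib sum.distrib)
    show "R (fscale c y) = fscale c (R y)" for c y
      by (simp add: R_def cfun.scale_sum_right)
  qed
  have interp: "R (sample m (nth xs) f) = interpolant (set xs) f" for f
  proof -
    have "bij_betw (nth xs) {..<m} (set xs)"
      using bij_betw_nth[OF volume_pos_distinct[OF xs(3,2)]] xs(1) by blast
    from sum.reindex_bij_betw[OF this, of "\<lambda>y. fscale (f y) (lagrange (set xs) y)"]
    show ?thesis unfolding R_def sample_def by simp
  qed
  let ?g = "sampling_number D H nrm (linf D) (linf_norm D) m"
  have le: "?g \<le> worst_case_error H nrm (linf_norm D) (\<lambda>f. interpolant (set xs) f)"
    unfolding sampling_number_def
    by (rule INF_lower2[of "nth xs"], use xs in force, rule INF_lower2[of R], use R in simp) (simp add: interp)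
  \<comment> \<open>With the factor on this side, the infimum over \<open>A\<close> can be taken
    directly.\<close>
  have "ennreal (1/4) * ?g \<le> worst_case_error H nrm (linf_norm D) A"
    if A: "clinear_map H (linf D) A" "finite_dim (A ` H)" "cfun.dim (A ` H) < n" for A
  proof (cases "worst_case_error H nrm (linf_norm D) A = top")
    case False
    define e where "e = enn2real (worst_case_error H nrm (linf_norm D) A)"
    have e: "0 \<le> e" and wce: "worst_case_error H nrm (linf_norm D) A = ennreal e"
      using False by (auto simp: e_def less_top)
    have err: "cmod (f x - A f x) \<le> e" if f: "f \<in> H" "nrm f \<le> 1" and x: "x \<in> D" for f x
    proof -
      have "ennreal (linf_norm D (f - A f)) \<le> ennreal e"
        unfolding wce[symmetric] worst_case_error_def using f by (intro SUP_upper) auto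
      then have "linf_norm D (f - A f) \<le> e" using e by (simp add: ennreal_le_iff)
      moreover have "f - A f \<in> linf D"
        using A(1) f(1) subset_linf[OF bdd] by (intro diff_in_linf) (auto simp: clinear_map_def)
      ultimately show ?thesis using cmod_le_linf_norm[of "f - A f" x] x by simp
    qed
    have res: "nrm (residual (set xs) x) \<le> 4 * e" if x: "x \<in> D" for x
    proof -
      let ?r = "real (cfun.dim (A ` H))" and ?s = "nrm (residual (set xs) x)"
      \<comment> \<open>The rank is below \<open>n\<close> and \<open>2 * n \<le> m\<close>, so at
        least half of \<open>m + 1\<close> remains after subtracting it.\<close>
      have "(real m + 1) / 2 * ?s \<le> (real m + 1 - ?r) * ?s"
        using A(3) n uni x by (intro mult_right_mono nrm_nonneg residual_mem) auto
      also have "\<dots> \<le> 2 * (real m + 1) * e"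
        using almost_maximal_volume_residual_le[OF xs(2,3) max[folded xs(1)] A(1,2) err e x]
        unfolding xs(1) .
      finally have "(real m + 1) * ?s \<le> (real m + 1) * (4 * e)" by argo
      then show ?thesis by (rule mult_left_le_imp_le) simp
    qed
    have "worst_case_error H nrm (linf_norm D) (\<lambda>f. interpolant (set xs) f) \<le> ennreal (4 * e)"
      unfolding worst_case_error_def
    proof (rule SUP_least, intro ennreal_leI)
      fix f assume "f \<in> {f \<in> H. nrm f \<le> 1}"
      then have f: "f \<in> H" "nrm f \<le> 1" by auto
      have "cmod ((f - interpolant (set xs) f) x) \<le> 4 * e" if "x \<in> D" for x
      proof -
        have "cmod (f x - interpolant (set xs) f x) \<le> nrm f * nrm (residual (set xs) x)"
          by (rule interpolation_error_le[OF uni f(1) that])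
        also have "\<dots> \<le> 1 * (4 * e)"
          using f res[OF that] e by (intro mult_mono nrm_nonneg residual_mem uni(1,2) that) auto
        finally show ?thesis by simp
      qed
      then show "linf_norm D (f - interpolant (set xs) f) \<le> 4 * e"
        unfolding linf_norm_def by (intro cSUP_least \<open>D \<noteq> {}\<close>)
    qed
    with le have "?g \<le> ennreal (4 * e)" by (rule order_trans)
    then have "ennreal (1/4) * ?g \<le> ennreal (1/4) * ennreal (4 * e)"
      by (rule mult_left_mono) simp
    also have "\<dots> = ennreal e" using e by (subst ennreal_mult[symmetric]) auto
    finally show ?thesis unfolding wce .
  qed simp
  then have "ennreal (1/4) * ?g \<le> approx_number H nrm (linf D) (linf_norm D) n"
    unfolding approx_number_def by (intro INF_greatest) auto
  then have "ennreal 4 * (ennreal (1/4) * ?g) \<le> ennreal 4 * approx_number H nrm (linf D) (linf_norm D) n"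
    by (rule mult_left_mono) simp
  moreover have "ennreal 4 * ennreal (1/4) = 1"
    by (subst ennreal_mult[symmetric]) auto
  ultimately show ?thesis by (simp only: mult.assoc[symmetric] mult_1_left)
qed

end

section \<open>Choice of the constants\<close>

theorem corollary4p3:
  shows "\<exists>c5 c6 :: real. 0 < c5 \<and> 0 < c6 \<and>
    (\<forall>(d :: nat) (D :: (nat \<Rightarrow> real) set) (K :: (nat \<Rightarrow> real) \<Rightarrow> (nat \<Rightarrow> real) \<Rightarrow> complex) H ip M.
       D \<subseteq> topspace (Euclidean_space d) \<longrightarrow>
       compact D \<longrightarrow>
       continuous_on (D \<times> D) (\<lambda>(x, y). K x y) \<longrightarrow>
       hermitian_kernel D K \<longrightarrow>
       positive_definite_kernel D K \<longrightarrow>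
       bdd_above ((\<lambda>x. sqrt (Re (K x x))) ` D) \<longrightarrow>
       rkhs D K H ip \<longrightarrow>
       \<not> finite_dim H \<longrightarrow>
       finite_borel_measure_on D M \<longrightarrow>
       full_support D M \<longrightarrow>
       (\<exists>lam e. eigensystem H ip M lam e \<and> christoffel D lam e \<in> O(\<lambda>k. real k)) \<longrightarrow>
       (\<exists>C :: real. 0 < C \<and> (\<forall>m::nat. 2 \<le> m \<longrightarrow>
          sampling_number D H (hnorm ip) (linf D) (linf_norm D) m
          \<le> ennreal C *
             min (approx_number H (hnorm ip) (linf D) (linf_norm D)
                    (nat \<lfloor>real m / (c6 * ln (real m))\<rfloor>))
                 (ennreal (sqrt (ln (real m))) *
                  approx_number H (hnorm ip) (linf D) (linf_norm D)
                    (nat \<lfloor>c5 * real m\<rfloor>)))))"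
proof (rule exI[of _ "1/2"], rule exI[of _ 4], intro conjI allI impI)
  fix d :: nat and D :: "(nat \<Rightarrow> real) set" and K H ip and M :: "(nat \<Rightarrow> real) measure"
  assume bdd: "bdd_above ((\<lambda>x. sqrt (Re (K x x))) ` D)"
    and "rkhs D K H ip" and inf_dim: "\<not> finite_dim H"
  interpret rkhs D K H ip by fact
  let ?g = "sampling_number D H (hnorm ip) (linf D) (linf_norm D)"
    and ?a = "approx_number H (hnorm ip) (linf D) (linf_norm D)"
  \<comment> \<open>For \<open>m \<ge> 2\<close>, \<open>4 * ln m\<close> is at least 8/3, so both
    indices are at most \<open>m / 2\<close>. The constant 8 instead of 4 absorbs
    \<open>sqrt (ln m)\<close>, which may be below 1 but is at least 1/2.\<close>
  have "?g m \<le> ennreal 8 * min (?a (nat \<lfloor>real m / (4 * ln (real m))\<rfloor>))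
      (ennreal (sqrt (ln (real m))) * ?a (nat \<lfloor>1 / 2 * real m\<rfloor>))" if m: "2 \<le> m" for m
  proof -
    have "2 / 3 \<le> ln (2::real)" by (rule ln2_ge_two_thirds)
    also have "ln 2 \<le> ln (real m)" using m by simp
    finally have ln: "2 / 3 \<le> ln (real m)" .
    have "real m / (4 * ln (real m)) \<le> real m / 2"
      using ln by (intro divide_left_mono) auto
    then have "2 * nat \<lfloor>real m / (4 * ln (real m))\<rfloor> \<le> m"
      using ln by linarith
    from sampling_number_le_approx_number[OF inf_dim bdd this]
    have "?g m \<le> ennreal 4 * ?a (nat \<lfloor>real m / (4 * ln (real m))\<rfloor>)" .
    also have "\<dots> \<le> ennreal 8 * ?a (nat \<lfloor>real m / (4 * ln (real m))\<rfloor>)"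
      by (intro mult_right_mono ennreal_leI) auto
    finally have 1: "?g m \<le> ennreal 8 * ?a (nat \<lfloor>real m / (4 * ln (real m))\<rfloor>)" .
    have "1 / 2 \<le> sqrt (ln (real m))"
      using ln by (intro real_le_rsqrt) (simp add: power2_eq_square)
    then have "ennreal 4 \<le> ennreal (8 * sqrt (ln (real m)))" by (intro ennreal_leI) simp
    also have "\<dots> = ennreal 8 * ennreal (sqrt (ln (real m)))"
      using ln by (intro ennreal_mult) auto
    finally have 4: "ennreal 4 \<le> ennreal 8 * ennreal (sqrt (ln (real m)))" .
    have "2 * nat \<lfloor>1 / 2 * real m\<rfloor> \<le> m" by linarith
    from sampling_number_le_approx_number[OF inf_dim bdd this]
    have "?g m \<le> ennreal 4 * ?a (nat \<lfloor>1 / 2 * real m\<rfloor>)" .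
    also have "\<dots> \<le> ennreal 8 * (ennreal (sqrt (ln (real m))) * ?a (nat \<lfloor>1 / 2 * real m\<rfloor>))"
      unfolding mult.assoc[symmetric] by (rule mult_right_mono[OF 4]) simp
    finally show ?thesis using 1 by (simp add: min_def)
  qed
  then show "\<exists>C::real. 0 < C \<and> (\<forall>m\<ge>2. ?g m
      \<le> ennreal C * min (?a (nat \<lfloor>real m / (4 * ln (real m))\<rfloor>))
        (ennreal (sqrt (ln (real m))) * ?a (nat \<lfloor>1 / 2 * real m\<rfloor>)))"
    by (intro exI[of _ 8]) simp
qed simp_all

end
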